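(* Let $R=(G,\Phi,\Phi^+)$ be a faithful signed groupoid set. Assume that $R$ is finite and complete. Then the signed groupoid set $R^\Box$ is finite and complete.
   Context: For a groupoid $G$, ${}_aG_b$ is the set of morphisms $b\to a$, ${}_aG$ the set of morphisms with codomain $a$, $1_a$ the identity at $a$; $fg$ means first $g$, then $f$. A definitely involuted set is a set $E$ with a fixed-point-free involution $x\mapsto -x$ and a subset $E^+$ such that $E=E^+\sqcup E^-$, $E^-:=-E^+$. A signed groupoid set $R=(G,\Phi,\Phi^+)$ is a groupoid $G$ with a family of definitely involuted sets ${}_a\Phi$ (positive part ${}_a\Phi^+$), $a\in\mathrm{Ob}(G)$, and maps ${}_aG_b\times{}_b\Phi\to{}_a\Phi$ with $1_b(x)=x$, $f(g(x))=(fg)(x)$, $f(-x)=-f(x)$ (positivity need not be preserved). $R$ is finite if $G$ has finitely many morphisms and all ${}_a\Phi$ are finite. For $g\in{}_aG_b$, $\Phi_g:=\{\alpha\in{}_a\Phi^+\mid g^{-1}(\alpha)\in{}_b\Phi^-\}$. $R$ is faithful if $\Phi_g=\emptyset$ implies $g$ is an identity. For faithful $R$, the weak order at $a$ is the partial order on ${}_aG$ with $g\le h\iff\Phi_g\subseteq\Phi_h$. $R$ is complete if every weak order is a complete lattice. For faithful $R$, a square is a quadruple $(x,w,y,z)$ of morphisms $w\colon a\to b$, $x\colon b\to d$, $z\colon a\to c$, $y\colon c\to d$ with $xw=yz$ and $x(\Phi_w)=\Phi_y$. The groupoid $G^\Box$ has objects $(a,X)$ with $a\in\mathrm{Ob}(G)$,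 $X\subseteq{}_aG$; a morphism $(a,X)\to(b,Y)$ is a morphism $f\colon a\to b$ of $G$ for which there is a bijection $\sigma_f\colon X\to Y$ such that $(f,g,\sigma_f(g),\sigma_f(g)^{-1}fg)$ is a square for all $g\in X$ (equivalently $f(\Phi_g)=\Phi_{\sigma_f(g)}$ for all $g\in X$); composition is as in $G$. $R^\Box=(G^\Box,\Psi,\Psi^+)$ with ${}_{(a,X)}\Psi={}_a\Phi$, ${}_{(a,X)}\Psi^+={}_a\Phi^+$ and action inherited from $G$; it is a faithful signed groupoid set. *)

theory Defs
  imports "HOL-Algebra.Complete_Lattice"
begin

section \<open>Groupoids\<close>

text \<open>
  Composition is written as for functions: \<open>f \<cdot> g\<close> means first \<open>g\<close>, then \<open>f\<close>, and is
  only meaningful when \<open>src f = tgt g\<close>. The fields are unconstrained outside \<open>obj\<close> and \<open>mor\<close>.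
\<close>

record ('o, 'm) groupoid =
  obj :: "'o set"
  mor :: "'m set"
  src :: "'m \<Rightarrow> 'o"
  tgt :: "'m \<Rightarrow> 'o"
  idm :: "'o \<Rightarrow> 'm"
  cmp :: "'m \<Rightarrow> 'm \<Rightarrow> 'm"  (infixl "\<cdot>\<index>" 70)

locale groupoid =
  fixes R :: "('o, 'm, 'e) groupoid_scheme" (structure)
  assumes src_closed: "f \<in> mor R \<Longrightarrow> src R f \<in> obj R"
    and tgt_closed: "f \<in> mor R \<Longrightarrow> tgt R f \<in> obj R"
    and idm_closed: "a \<in> obj R \<Longrightarrow> idm R a \<in> mor R"
    and src_idm: "a \<in> obj R \<Longrightarrow> src R (idm R a) = a"
    and tgt_idm: "a \<in> obj R \<Longrightarrow> tgt R (idm R a) = a"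
    and cmp_closed: "\<lbrakk>f \<in> mor R; g \<in> mor R; src R f = tgt R g\<rbrakk> \<Longrightarrow> f \<cdot> g \<in> mor R"
    and src_cmp: "\<lbrakk>f \<in> mor R; g \<in> mor R; src R f = tgt R g\<rbrakk> \<Longrightarrow> src R (f \<cdot> g) = src R g"
    and tgt_cmp: "\<lbrakk>f \<in> mor R; g \<in> mor R; src R f = tgt R g\<rbrakk> \<Longrightarrow> tgt R (f \<cdot> g) = tgt R f"
    and cmp_assoc: "\<lbrakk>f \<in> mor R; g \<in> mor R; h \<in> mor R; src R f = tgt R g; src R g = tgt R h\<rbrakk>
      \<Longrightarrow> (f \<cdot> g) \<cdot> h = f \<cdot> (g \<cdot> h)"
    and idm_left: "f \<in> mor R \<Longrightarrow> idm R (tgt R f) \<cdot> f = f"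
    and idm_right: "f \<in> mor R \<Longrightarrow> f \<cdot> idm R (src R f) = f"
    and inverse_exists: "f \<in> mor R \<Longrightarrow> \<exists>h\<in>mor R. src R h = tgt R f \<and> tgt R h = src R f \<and>
      h \<cdot> f = idm R (src R f) \<and> f \<cdot> h = idm R (tgt R f)"

definition ginv :: "('o, 'm, 'e) groupoid_scheme \<Rightarrow> 'm \<Rightarrow> 'm" where
  "ginv R f = (THE h. h \<in> mor R \<and> src R h = tgt R f \<and> tgt R h = src R f \<and>
     h \<cdot>\<^bsub>R\<^esub> f = idm R (src R f) \<and> f \<cdot>\<^bsub>R\<^esub> h = idm R (tgt R f))"

definition mors_into :: "('o, 'm, 'e) groupoid_scheme \<Rightarrow> 'o \<Rightarrow> 'm set" where
  "mors_into R a = {f \<in> mor R. tgt R f = a}"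


section \<open>Signed groupoid sets\<close>

definition definitely_involuted :: "'x set \<Rightarrow> ('x \<Rightarrow> 'x) \<Rightarrow> 'x set \<Rightarrow> bool" where
  "definitely_involuted E n P \<longleftrightarrow>
     (\<forall>x\<in>E. n x \<in> E \<and> n (n x) = x \<and> n x \<noteq> x) \<and> P \<subseteq> E \<and> E = P \<union> n ` P \<and> P \<inter> n ` P = {}"

text \<open>
  The fibres \<open>roots R a\<close> for distinct objects \<open>a\<close> may overlap in the type \<open>'x\<close>, so the
  involution \<open>neg\<close> takes the object as an argument; for the action the relevant fibres
  are determined by the source and target of the morphism.
\<close>

record ('o, 'm, 'x) signed_groupoid_set = "('o, 'm) groupoid" +
  roots :: "'o \<Rightarrow> 'x set"
  pos :: "'o \<Rightarrow> 'x set"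
  neg :: "'o \<Rightarrow> 'x \<Rightarrow> 'x"
  act :: "'m \<Rightarrow> 'x \<Rightarrow> 'x"

locale signed_groupoid_set = groupoid R
  for R :: "('o, 'm, 'x, 'e) signed_groupoid_set_scheme" (structure) +
  assumes involuted: "a \<in> obj R \<Longrightarrow> definitely_involuted (roots R a) (neg R a) (pos R a)"
    and act_closed: "\<lbrakk>f \<in> mor R; x \<in> roots R (src R f)\<rbrakk> \<Longrightarrow> act R f x \<in> roots R (tgt R f)"
    and act_idm: "\<lbrakk>a \<in> obj R; x \<in> roots R a\<rbrakk> \<Longrightarrow> act R (idm R a) x = x"
    and act_cmp: "\<lbrakk>f \<in> mor R; g \<in> mor R; src R f = tgt R g; x \<in> roots R (src R g)\<rbrakk>
      \<Longrightarrow> act R f (act R g x) = act R (f \<cdot> g) x"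
    and act_neg: "\<lbrakk>f \<in> mor R; x \<in> roots R (src R f)\<rbrakk>
      \<Longrightarrow> act R f (neg R (src R f) x) = neg R (tgt R f) (act R f x)"

definition inversions :: "('o, 'm, 'x, 'e) signed_groupoid_set_scheme \<Rightarrow> 'm \<Rightarrow> 'x set" where
  "inversions R g =
     {\<alpha> \<in> pos R (tgt R g). act R (ginv R g) \<alpha> \<in> neg R (src R g) ` pos R (src R g)}"

locale faithful_signed_groupoid_set = signed_groupoid_set +
  assumes faithful: "\<lbrakk>g \<in> mor R; inversions R g = {}\<rbrakk> \<Longrightarrow> \<exists>a\<in>obj R. g = idm R a"

definition finite_sgs :: "('o, 'm, 'x, 'e) signed_groupoid_set_scheme \<Rightarrow> bool" where
  "finite_sgs R \<longleftrightarrow> finite (mor R) \<and> (\<forall>a\<in>obj R. finite (roots R a))"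

definition weak_order :: "('o, 'm, 'x, 'e) signed_groupoid_set_scheme \<Rightarrow> 'o \<Rightarrow> 'm gorder" where
  "weak_order R a =
     \<lparr>carrier = mors_into R a, eq = (=), le = (\<lambda>g h. inversions R g \<subseteq> inversions R h)\<rparr>"

definition complete_sgs :: "('o, 'm, 'x, 'e) signed_groupoid_set_scheme \<Rightarrow> bool" where
  "complete_sgs R \<longleftrightarrow> (\<forall>a\<in>obj R. complete_lattice (weak_order R a))"


section \<open>Squares and the signed groupoid set \<open>R\<^sup>\<box>\<close>\<close>

definition is_square ::
    "('o, 'm, 'x, 'e) signed_groupoid_set_scheme \<Rightarrow> 'm \<Rightarrow> 'm \<Rightarrow> 'm \<Rightarrow> 'm \<Rightarrow> bool" where
  "is_square R x w y z \<longleftrightarrow>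
     x \<in> mor R \<and> w \<in> mor R \<and> y \<in> mor R \<and> z \<in> mor R \<and>
     src R w = src R z \<and> tgt R w = src R x \<and> tgt R z = src R y \<and> tgt R x = tgt R y \<and>
     x \<cdot>\<^bsub>R\<^esub> w = y \<cdot>\<^bsub>R\<^esub> z \<and> act R x ` inversions R w = inversions R y"

text \<open>
  A morphism of \<open>G\<^sup>\<box>\<close> carries its source and target, since the same \<open>f\<close> may underlie
  several morphisms: it is a triple \<open>((a, X), f, (b, Y))\<close>. The bijection \<open>\<sigma>\<^sub>f\<close> is only
  required to exist and is not part of the data.
\<close>

type_synonym ('o, 'm) box_obj = "'o \<times> 'm set"
type_synonym ('o, 'm) box_mor = "('o, 'm) box_obj \<times> 'm \<times> ('o, 'm) box_obj"

definition box_objs ::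
    "('o, 'm, 'x, 'e) signed_groupoid_set_scheme \<Rightarrow> ('o, 'm) box_obj set" where
  "box_objs R = {(a, X). a \<in> obj R \<and> X \<subseteq> mors_into R a}"

definition box_mors ::
    "('o, 'm, 'x, 'e) signed_groupoid_set_scheme \<Rightarrow> ('o, 'm) box_mor set" where
  "box_mors R = {((a, X), f, (b, Y)).
     (a, X) \<in> box_objs R \<and> (b, Y) \<in> box_objs R \<and> f \<in> mor R \<and> src R f = a \<and> tgt R f = b \<and>
     (\<exists>\<sigma>. bij_betw \<sigma> X Y \<and>
        (\<forall>g\<in>X. is_square R f g (\<sigma> g) (ginv R (\<sigma> g) \<cdot>\<^bsub>R\<^esub> f \<cdot>\<^bsub>R\<^esub> g)))}"

definition box :: "('o, 'm, 'x, 'e) signed_groupoid_set_scheme \<Rightarrow>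
    (('o, 'm) box_obj, ('o, 'm) box_mor, 'x) signed_groupoid_set" where
  "box R =
     \<lparr>obj = box_objs R,
      mor = box_mors R,
      src = (\<lambda>(A, f, B). A),
      tgt = (\<lambda>(A, f, B). B),
      idm = (\<lambda>(a, X). ((a, X), idm R a, (a, X))),
      cmp = (\<lambda>(A', g, B') (A, f, B). (A, g \<cdot>\<^bsub>R\<^esub> f, B')),
      roots = (\<lambda>(a, X). roots R a),
      pos = (\<lambda>(a, X). pos R a),
      neg = (\<lambda>(a, X). neg R a),
      act = (\<lambda>(A, f, B). act R f)\<rparr>"


subsection \<open>\<open>R\<^sup>\<box>\<close> is a faithful signed groupoid set\<close>

context groupoid
begin

lemma ginv_unique:
  assumes f: "f \<in> mor R"
    and h: "h \<in> mor R" "src R h = tgt R f" "tgt R h = src R f"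
      "h \<cdot> f = idm R (src R f)" "f \<cdot> h = idm R (tgt R f)"
  shows "ginv R f = h"
  unfolding ginv_def
proof (rule the_equality)
  fix k
  assume k: "k \<in> mor R \<and> src R k = tgt R f \<and> tgt R k = src R f \<and>
     k \<cdot> f = idm R (src R f) \<and> f \<cdot> k = idm R (tgt R f)"
  have "k = k \<cdot> (f \<cdot> h)" using k h idm_right[of k] by simp
  also have "\<dots> = (k \<cdot> f) \<cdot> h" using k h f cmp_assoc[of k f h] by simp
  also have "\<dots> = h" using k h idm_left[of h] by simp
  finally show "k = h" .
qed (use h in simp)

lemma ginv:
  assumes f: "f \<in> mor R"
  shows "ginv R f \<in> mor R" "src R (ginv R f) = tgt R f" "tgt R (ginv R f) = src R f"
    "ginv R f \<cdot> f = idm R (src R f)" "f \<cdot> ginv R f = idm R (tgt R f)"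
  using inverse_exists[OF f] ginv_unique[OF f] by metis+

end

context signed_groupoid_set
begin

lemma act_ginv_act:
  assumes "f \<in> mor R" "x \<in> roots R (src R f)"
  shows "act R (ginv R f) (act R f x) = x"
  using assms ginv[of f] act_cmp[of "ginv R f" f x] act_idm[of "src R f" x] src_closed[of f]
  by simp

lemma inversions_subset: "g \<in> mor R \<Longrightarrow> inversions R g \<subseteq> roots R (tgt R g)"
  using involuted[OF tgt_closed, of g] by (auto simp: inversions_def definitely_involuted_def)

lemma act_idm_image: "a \<in> obj R \<Longrightarrow> S \<subseteq> roots R a \<Longrightarrow> act R (idm R a) ` S = S"
  using act_idm[of a] by (auto simp: subset_iff image_iff)

lemma inversions_eq_image_ginv:
  assumes "f \<in> mor R" "g \<in> mor R" "tgt R g = src R f" "act R f ` inversions R g = T"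
  shows "act R (ginv R f) ` T = inversions R g"
  using act_ginv_act[OF assms(1)] inversions_subset[OF assms(2)] assms(3,4)
  by (force simp: image_image subset_iff)

lemma mem_box_mors_iff:
  "((a, X), f, (b, Y)) \<in> box_mors R \<longleftrightarrow>
     f \<in> mor R \<and> src R f = a \<and> tgt R f = b \<and> X \<subseteq> mors_into R a \<and> Y \<subseteq> mors_into R b \<and>
     (\<exists>\<sigma>. bij_betw \<sigma> X Y \<and> (\<forall>g\<in>X. act R f ` inversions R g = inversions R (\<sigma> g)))"
  (is "?L \<longleftrightarrow> ?Q")
proof
  assume ?L
  then have L: "X \<subseteq> mors_into R a" "Y \<subseteq> mors_into R b" "f \<in> mor R" "src R f = a" "tgt R f = b"
    "\<exists>\<sigma>. bij_betw \<sigma> X Y \<and>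
        (\<forall>g\<in>X. is_square R f g (\<sigma> g) (ginv R (\<sigma> g) \<cdot> f \<cdot> g))"
    by (simp_all add: box_mors_def box_objs_def)
  from L(6) obtain \<sigma> where "bij_betw \<sigma> X Y"
    "\<forall>g\<in>X. is_square R f g (\<sigma> g) (ginv R (\<sigma> g) \<cdot> f \<cdot> g)" by (elim exE conjE)
  then show ?Q using L(1-5) by (intro conjI exI[of _ \<sigma>]) (simp_all add: is_square_def)
next
  assume Q: ?Q
  then have "\<exists>\<sigma>. bij_betw \<sigma> X Y \<and> (\<forall>g\<in>X. act R f ` inversions R g = inversions R (\<sigma> g))"
    by (elim conjE)
  then obtain \<sigma> where \<sigma>: "bij_betw \<sigma> X Y"
    "\<And>g. g \<in> X \<Longrightarrow> act R f ` inversions R g = inversions R (\<sigma> g)" by (elim exE conjE) simp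
  have "is_square R f g (\<sigma> g) (ginv R (\<sigma> g) \<cdot> f \<cdot> g)" if g: "g \<in> X" for g
  proof -
    have gm: "g \<in> mor R" "tgt R g = src R f" using Q g by (auto simp: mors_into_def)
    have "\<sigma> g \<in> Y" using \<sigma>(1) g by (auto simp: bij_betw_def)
    then have sm: "\<sigma> g \<in> mor R" "tgt R (\<sigma> g) = tgt R f" using Q by (auto simp: mors_into_def)
    have f: "f \<in> mor R" using Q by simp
    have i: "ginv R (\<sigma> g) \<in> mor R" "src R (ginv R (\<sigma> g)) = tgt R f"
       "tgt R (ginv R (\<sigma> g)) = src R (\<sigma> g)" "\<sigma> g \<cdot> ginv R (\<sigma> g) = idm R (tgt R f)"
      using ginv[OF sm(1)] sm by auto
    have ifc: "ginv R (\<sigma> g) \<cdot> f \<in> mor R" "src R (ginv R (\<sigma> g) \<cdot> f) = src R f"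
       "tgt R (ginv R (\<sigma> g) \<cdot> f) = src R (\<sigma> g)"
      using cmp_closed src_cmp tgt_cmp i f by auto
    have "\<sigma> g \<cdot> (ginv R (\<sigma> g) \<cdot> f) = f"
      using cmp_assoc[of "\<sigma> g" "ginv R (\<sigma> g)" f] sm i f idm_left[of f] by simp
    then have "\<sigma> g \<cdot> (ginv R (\<sigma> g) \<cdot> f \<cdot> g) = f \<cdot> g"
      using cmp_assoc[of "\<sigma> g" "ginv R (\<sigma> g) \<cdot> f" g] sm ifc gm by simp
    then show ?thesis
      unfolding is_square_def
      using \<sigma>(2)[OF g] f gm sm cmp_closed[OF ifc(1) gm(1)] src_cmp[OF ifc(1) gm(1)]
        tgt_cmp[OF ifc(1) gm(1)] ifc by simp
  qed
  then have "\<exists>\<sigma>. bij_betw \<sigma> X Y \<and>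
        (\<forall>g\<in>X. is_square R f g (\<sigma> g) (ginv R (\<sigma> g) \<cdot> f \<cdot> g))"
    using \<sigma>(1) by (intro exI[of _ \<sigma>]) simp
  then show ?L
    using Q src_closed[of f] tgt_closed[of f] by (simp add: box_mors_def box_objs_def)
qed

lemma box_morsE:
  assumes "((a, X), f, (b, Y)) \<in> box_mors R"
  obtains \<sigma> where "f \<in> mor R" "src R f = a" "tgt R f = b"
    "X \<subseteq> mors_into R a" "Y \<subseteq> mors_into R b" "bij_betw \<sigma> X Y"
    "\<And>g. g \<in> X \<Longrightarrow> act R f ` inversions R g = inversions R (\<sigma> g)"
proof -
  note Q = assms[unfolded mem_box_mors_iff]
  from Q have "\<exists>\<sigma>. bij_betw \<sigma> X Y \<and> (\<forall>g\<in>X. act R f ` inversions R g = inversions R (\<sigma> g))"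
    by (elim conjE)
  then obtain \<sigma> where "bij_betw \<sigma> X Y"
    "\<forall>g\<in>X. act R f ` inversions R g = inversions R (\<sigma> g)" by (elim exE conjE)
  with Q show thesis by (intro that) simp_all
qed

lemma box_mors_cmp:
  assumes "(A, f, B) \<in> box_mors R" "(B, g, C) \<in> box_mors R"
  shows "(A, g \<cdot> f, C) \<in> box_mors R"
proof -
  obtain a X where A: "A = (a, X)" by (cases A)
  obtain b Y where B: "B = (b, Y)" by (cases B)
  obtain c Z where C: "C = (c, Z)" by (cases C)
  note eq = A B C
  obtain \<sigma> where f: "f \<in> mor R" "src R f = a" "tgt R f = b" "X \<subseteq> mors_into R a"
      "Y \<subseteq> mors_into R b"
    and \<sigma>: "bij_betw \<sigma> X Y" "\<And>h. h \<in> X \<Longrightarrow> act R f ` inversions R h = inversions R (\<sigma> h)"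
    using assms(1) unfolding eq by (rule box_morsE) (rule that)
  obtain \<tau> where g: "g \<in> mor R" "src R g = b" "tgt R g = c" "Y \<subseteq> mors_into R b"
      "Z \<subseteq> mors_into R c"
    and \<tau>: "bij_betw \<tau> Y Z" "\<And>h. h \<in> Y \<Longrightarrow> act R g ` inversions R h = inversions R (\<tau> h)"
    using assms(2) unfolding eq by (rule box_morsE) (rule that)
  have "act R (g \<cdot> f) ` inversions R h = inversions R ((\<tau> \<circ> \<sigma>) h)" if h: "h \<in> X" for h
  proof -
    have "h \<in> mor R" "tgt R h = src R f" using h f by (auto simp: mors_into_def)
    then have "inversions R h \<subseteq> roots R (src R f)" using inversions_subset by metis
    then have "act R (g \<cdot> f) ` inversions R h = act R g ` (act R f ` inversions R h)"
      unfolding image_image using act_cmp[of g f] f g by (intro image_cong) (simp_all add: subset_iff)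
    also have "\<dots> = inversions R (\<tau> (\<sigma> h))"
      using \<sigma> \<tau> h by (metis bij_betwE)
    finally show ?thesis by simp
  qed
  moreover have "bij_betw (\<tau> \<circ> \<sigma>) X Z" using bij_betw_trans[OF \<sigma>(1) \<tau>(1)] .
  ultimately show ?thesis
    unfolding eq mem_box_mors_iff
    using f g cmp_closed[of g f] src_cmp[of g f] tgt_cmp[of g f]
    by (intro conjI exI[of _ "\<tau> \<circ> \<sigma>"] ballI) simp_all
qed

lemma box_mors_idm:
  assumes "(a, X) \<in> box_objs R"
  shows "((a, X), idm R a, (a, X)) \<in> box_mors R"
proof -
  have a: "a \<in> obj R" "X \<subseteq> mors_into R a" using assms by (auto simp: box_objs_def)
  have "act R (idm R a) ` inversions R g = inversions R (id g)" if g: "g \<in> X" for g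
  proof -
    have "g \<in> mor R" "tgt R g = a" using a g by (auto simp: mors_into_def)
    then show ?thesis using act_idm_image[OF a(1)] inversions_subset[of g] by simp
  qed
  then show ?thesis
    unfolding mem_box_mors_iff
    using a idm_closed src_idm tgt_idm
    by (intro conjI exI[of _ id] ballI) simp_all
qed

lemma box_mors_ginv:
  assumes "(A, f, B) \<in> box_mors R"
  shows "(B, ginv R f, A) \<in> box_mors R"
proof -
  obtain a X where A: "A = (a, X)" by (cases A)
  obtain b Y where B: "B = (b, Y)" by (cases B)
  note eq = A B
  obtain \<sigma> where f: "f \<in> mor R" "src R f = a" "tgt R f = b" "X \<subseteq> mors_into R a" "Y \<subseteq> mors_into R b"
    and \<sigma>: "bij_betw \<sigma> X Y" "\<And>h. h \<in> X \<Longrightarrow> act R f ` inversions R h = inversions R (\<sigma> h)"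
    using assms(1) unfolding eq by (rule box_morsE) (rule that)
  have "act R (ginv R f) ` inversions R k = inversions R (inv_into X \<sigma> k)" if k: "k \<in> Y" for k
  proof -
    define h where "h = inv_into X \<sigma> k"
    have h: "h \<in> X" "\<sigma> h = k"
      using k \<sigma>(1) unfolding h_def
      by (metis bij_betw_imp_surj_on inv_into_into) (metis bij_betw_inv_into_right k \<sigma>(1))
    show ?thesis
      unfolding h_def[symmetric]
      using inversions_eq_image_ginv[of f h] \<sigma>(2)[OF h(1)] h f by (auto simp: mors_into_def)
  qed
  then show ?thesis
    unfolding eq mem_box_mors_iff
    using f ginv[of f] bij_betw_inv_into[OF \<sigma>(1)]
    by (intro conjI exI[of _ "inv_into X \<sigma>"] ballI) simp_all
qed

lemma box_mors_D:
  assumes "(A, f, B) \<in> box_mors R"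
  shows "f \<in> mor R" "src R f = fst A" "tgt R f = fst B" "A \<in> box_objs R" "B \<in> box_objs R"
  using assms by (auto simp: box_mors_def)

lemma box_groupoid: "groupoid (box R)"
proof
  fix p assume p: "p \<in> mor (box R)"
  obtain A f B where eq: "p = (A, f, B)" by (cases p)
  have m: "(A, f, B) \<in> box_mors R" using p by (simp add: eq box_def)
  note d = box_mors_D[OF m]
  show "src (box R) p \<in> obj (box R)" "tgt (box R) p \<in> obj (box R)"
    using d by (auto simp: eq box_def)
  show "idm (box R) (tgt (box R) p) \<cdot>\<^bsub>box R\<^esub> p = p"
    using d idm_left[of f] by (auto simp: eq box_def split: prod.splits)
  show "p \<cdot>\<^bsub>box R\<^esub> idm (box R) (src (box R) p) = p"
    using d idm_right[of f] by (auto simp: eq box_def split: prod.splits)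
  show "\<exists>h\<in>mor (box R). src (box R) h = tgt (box R) p \<and> tgt (box R) h = src (box R) p \<and>
      h \<cdot>\<^bsub>box R\<^esub> p = idm (box R) (src (box R) p) \<and> p \<cdot>\<^bsub>box R\<^esub> h = idm (box R) (tgt (box R) p)"
    using box_mors_ginv[OF m] ginv[OF d(1)] d
    by (intro bexI[of _ "(B, ginv R f, A)"]) (auto simp: eq box_def split: prod.splits)
next
  fix A assume "A \<in> obj (box R)"
  then show "idm (box R) A \<in> mor (box R)" "src (box R) (idm (box R) A) = A"
    "tgt (box R) (idm (box R) A) = A"
    using box_mors_idm by (auto simp: box_def split: prod.splits)
next
  fix p q assume pq: "p \<in> mor (box R)" "q \<in> mor (box R)" "src (box R) p = tgt (box R) q"
  show "p \<cdot>\<^bsub>box R\<^esub> q \<in> mor (box R)" "src (box R) (p \<cdot>\<^bsub>box R\<^esub> q) = src (box R) q"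
    "tgt (box R) (p \<cdot>\<^bsub>box R\<^esub> q) = tgt (box R) p"
    using pq box_mors_cmp by (auto simp: box_def split: prod.splits)
  fix r assume r: "r \<in> mor (box R)" "src (box R) q = tgt (box R) r"
  show "(p \<cdot>\<^bsub>box R\<^esub> q) \<cdot>\<^bsub>box R\<^esub> r = p \<cdot>\<^bsub>box R\<^esub> (q \<cdot>\<^bsub>box R\<^esub> r)"
  proof -
    obtain A f B where p': "p = (A, f, B)" by (cases p)
    obtain C g D where q': "q = (C, g, D)" by (cases q)
    obtain E h F where r': "r = (E, h, F)" by (cases r)
    note eq = p' q' r'
    have m: "(A, f, B) \<in> box_mors R" "(C, g, D) \<in> box_mors R" "(E, h, F) \<in> box_mors R"
      and e: "A = D" "C = F"
      using pq r by (simp_all add: eq box_def)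
    show ?thesis
      using box_mors_D[OF m(1)] box_mors_D[OF m(2)] box_mors_D[OF m(3)] e cmp_assoc[of f g h]
      by (simp add: eq box_def)
  qed
qed

lemma box_signed_groupoid_set: "signed_groupoid_set (box R)"
proof -
  interpret B: groupoid "box R" by (rule box_groupoid)
  show ?thesis
  proof
    fix A assume "A \<in> obj (box R)"
    then show "definitely_involuted (roots (box R) A) (neg (box R) A) (pos (box R) A)"
      using involuted by (auto simp: box_def box_objs_def)
  next
    fix A x assume "A \<in> obj (box R)" "x \<in> roots (box R) A"
    then show "act (box R) (idm (box R) A) x = x"
      using act_idm by (auto simp: box_def box_objs_def)
  next
    fix p x assume p: "p \<in> mor (box R)" "x \<in> roots (box R) (src (box R) p)"
    obtain a X f b Y where eq: "p = ((a, X), f, (b, Y))" by (cases p; auto)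
    have m: "((a, X), f, (b, Y)) \<in> box_mors R" using p by (simp add: eq box_def)
    show "act (box R) p x \<in> roots (box R) (tgt (box R) p)"
      using p act_closed[of f x] box_mors_D[OF m] by (simp add: eq box_def)
    show "act (box R) p (neg (box R) (src (box R) p) x) =
        neg (box R) (tgt (box R) p) (act (box R) p x)"
      using p act_neg[of f x] box_mors_D[OF m] by (simp add: eq box_def)
  next
    fix p q x
    assume p: "p \<in> mor (box R)" "q \<in> mor (box R)" "src (box R) p = tgt (box R) q"
      "x \<in> roots (box R) (src (box R) q)"
    obtain a X f b Y where p': "p = ((a, X), f, (b, Y))" by (cases p; auto)
    obtain c Z g d W where q': "q = ((c, Z), g, (d, W))" by (cases q; auto)
    note eq = p' q'
    have m: "((a, X), f, (b, Y)) \<in> box_mors R" "((c, Z), g, (d, W)) \<in> box_mors R" "d = a"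
      using p by (simp_all add: eq box_def)
    show "act (box R) p (act (box R) q x) = act (box R) (p \<cdot>\<^bsub>box R\<^esub> q) x"
      using p act_cmp[of f g x] box_mors_D[OF m(1)] box_mors_D[OF m(2)] m(3)
      by (simp add: eq box_def)
  qed
qed

lemma ginv_box:
  assumes "(A, f, B) \<in> box_mors R"
  shows "ginv (box R) (A, f, B) = (B, ginv R f, A)"
proof -
  interpret B: groupoid "box R" by (rule box_groupoid)
  show ?thesis
    using assms box_mors_ginv[OF assms] box_mors_D[OF assms] ginv[of f]
    by (intro B.ginv_unique) (auto simp: box_def split: prod.splits)
qed

lemma inversions_box:
  assumes "(A, f, B) \<in> box_mors R"
  shows "inversions (box R) (A, f, B) = inversions R f"
  using box_mors_D[OF assms] ginv_box[OF assms]
  by (cases A, cases B) (simp add: inversions_def box_def)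

end

context faithful_signed_groupoid_set
begin

lemma inversions_inj:
  assumes g: "g \<in> mor R" and h: "h \<in> mor R" and t: "tgt R g = tgt R h"
    and eq: "inversions R g = inversions R h"
  shows "g = h"
proof -
  define k where "k = ginv R g \<cdot> h"
  define k' where "k' = ginv R h \<cdot> g"
  note gi = ginv[OF g] and hi = ginv[OF h]
  have k: "k \<in> mor R" "src R k = src R h" "tgt R k = src R g"
    using cmp_closed[of "ginv R g" h] src_cmp[of "ginv R g" h] tgt_cmp[of "ginv R g" h] gi h t
    unfolding k_def by auto
  have k': "k' \<in> mor R" "src R k' = src R g" "tgt R k' = src R h"
    using cmp_closed[of "ginv R h" g] src_cmp[of "ginv R h" g] tgt_cmp[of "ginv R h" g] hi g t
    unfolding k'_def by auto
  have gk: "g \<cdot> k = h"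
    using cmp_assoc[of g "ginv R g" h] gi g h t idm_left[of h] unfolding k_def by simp
  have hk: "h \<cdot> k' = g"
    using cmp_assoc[of h "ginv R h" g] hi g h t idm_left[of g] unfolding k'_def by simp
  have "k \<cdot> k' = ginv R g \<cdot> g"
    using cmp_assoc[of "ginv R g" h k'] gi h t k' hk unfolding k_def by simp
  moreover have "k' \<cdot> k = ginv R h \<cdot> h"
    using cmp_assoc[of "ginv R h" g k] hi g t k gk unfolding k'_def by simp
  ultimately have kinv: "ginv R k = k'"
    using ginv_unique[of k k'] k k' gi hi by simp
  have inv: "definitely_involuted (roots R (src R f)) (neg R (src R f)) (pos R (src R f))"
    "definitely_involuted (roots R (tgt R f)) (neg R (tgt R f)) (pos R (tgt R f))"
    if "f \<in> mor R" for f
    using involuted src_closed tgt_closed that by auto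
  have "inversions R k = {}"
  proof (rule ccontr)
    assume "inversions R k \<noteq> {}"
    then obtain b where b: "b \<in> pos R (src R g)"
      "act R k' b \<in> neg R (src R h) ` pos R (src R h)"
      unfolding inversions_def kinv k by blast
    define a where "a = act R g b"
    have br: "b \<in> roots R (src R g)" using b inv(1)[OF g] by (auto simp: definitely_involuted_def)
    have ar: "a \<in> roots R (tgt R g)" unfolding a_def using act_closed g br by simp
    have ga: "act R (ginv R g) a = b" unfolding a_def using act_ginv_act g br by simp
    have ha: "act R (ginv R h) a = act R k' b"
      unfolding a_def k'_def using act_cmp[of "ginv R h" g b] hi g t br by simp
    show False
    proof (cases "a \<in> pos R (tgt R g)")
      case True
      then have "a \<in> inversions R h" using b ha t by (simp add: inversions_def)
      then have "a \<in> inversions R g" using eq by simp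
      then have "b \<in> neg R (src R g) ` pos R (src R g)" using ga by (simp add: inversions_def)
      then show False using b inv(1)[OF g] by (auto simp: definitely_involuted_def)
    next
      case False
      then obtain c where c: "c \<in> pos R (tgt R g)" "a = neg R (tgt R g) c"
        using ar inv(2)[OF g] by (auto simp: definitely_involuted_def)
      have c2: "neg R (tgt R g) a = c" using c inv(2)[OF g] by (auto simp: definitely_involuted_def)
      have "act R (ginv R g) c = neg R (src R g) b"
        using act_neg[of "ginv R g" a] gi ar ga c2 by simp
      then have "c \<in> inversions R g" using c b by (simp add: inversions_def)
      then have "c \<in> inversions R h" using eq by simp
      then have "act R (ginv R h) c \<in> neg R (src R h) ` pos R (src R h)"
        by (simp add: inversions_def)
      moreover have "act R (ginv R h) c = neg R (src R h) (act R k' b)"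
        using act_neg[of "ginv R h" a] hi ar ha c2 t by simp
      ultimately show False using b inv(1)[OF h] by (auto simp: definitely_involuted_def)
    qed
  qed
  then obtain a where "a \<in> obj R" "k = idm R a" using faithful k(1) by blast
  then have "k = idm R (src R g)" using k tgt_idm by metis
  then show ?thesis using gk idm_right[OF g] by simp
qed

theorem box_faithful_signed_groupoid_set: "faithful_signed_groupoid_set (box R)"
proof -
  interpret B: signed_groupoid_set "box R" by (rule box_signed_groupoid_set)
  show ?thesis
  proof
    fix p assume p: "p \<in> mor (box R)" "inversions (box R) p = {}"
    obtain a X f b Y where eq: "p = ((a, X), f, (b, Y))" by (cases p; auto)
    have m: "((a, X), f, (b, Y)) \<in> box_mors R" using p by (simp add: eq box_def)
    note d = box_mors_D[OF m]
    obtain c where "c \<in> obj R" "f = idm R c"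
      using faithful[OF d(1)] inversions_box[OF m] p(2) eq by auto
    then have f: "f = idm R a" "b = a" "a \<in> obj R" using d src_idm tgt_idm by auto
    obtain \<sigma> where "idm R a \<in> mor R" "src R (idm R a) = a" "tgt R (idm R a) = a"
      and X: "X \<subseteq> mors_into R a" "Y \<subseteq> mors_into R a" and \<sigma>: "bij_betw \<sigma> X Y"
      "\<And>g. g \<in> X \<Longrightarrow> act R (idm R a) ` inversions R g = inversions R (\<sigma> g)"
      using m unfolding f by (rule box_morsE) (rule that)
    have "\<sigma> g = g" if g: "g \<in> X" for g
    proof -
      have gm: "g \<in> mor R" "tgt R g = a" using g X by (auto simp: mors_into_def)
      have sm: "\<sigma> g \<in> mor R" "tgt R (\<sigma> g) = a"
        using g X \<sigma>(1) by (auto simp: mors_into_def bij_betw_def)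
      have "inversions R g = inversions R (\<sigma> g)"
        using \<sigma>(2)[OF g] act_idm_image[OF f(3)] inversions_subset[OF gm(1)] gm(2) by simp
      then show ?thesis using inversions_inj[of g "\<sigma> g"] gm sm by simp
    qed
    then have "Y = X" using \<sigma>(1) by (auto simp: bij_betw_def)
    then show "\<exists>A\<in>obj (box R). p = idm (box R) A"
      using f d by (intro bexI[of _ "(a, X)"]) (auto simp: eq box_def)
  qed
qed

end

end

theory Submission
  imports Defs
begin

text \<open>
  A morphism of \<open>G\<^sup>\<box>\<close> into \<open>(b, Y)\<close> is determined by its underlying \<open>f\<close>, and \<open>f\<close> occurs iff for
  each \<open>y \<in> Y\<close> there is \<open>x\<close> with \<open>f(\<Phi>\<^sub>x) = \<Phi>\<^sub>y\<close>. Reflecting the square along its diagonal, this means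
  \<open>y(\<Phi>\<^sub>z) = \<Phi>\<^sub>f\<close> for some \<open>z\<close>. So it suffices that, for fixed \<open>y\<close>, the set of such \<open>f\<close> is closed
  under joins of the weak order at \<open>b\<close>; in fact the relation \<open>y(\<Phi>\<^sub>z) = \<Phi>\<^sub>f\<close> is preserved by taking joins
  in \<open>z\<close> and \<open>f\<close> simultaneously. The key point is that orthogonality \<open>\<Phi>\<^sub>f \<inter> \<Phi>\<^sub>y = {}\<close> passes to the join of
  a family \<open>f\<^sub>i\<close>: it says \<open>y\<inverse> \<le> y\<inverse> f\<^sub>i\<close>, so one may form the join of \<open>y\<inverse>\<close> and all \<open>y\<inverse> f\<^sub>i\<close> in the weak order
  at the source of \<open>y\<close> and translate back.
\<close>

section \<open>Joins in the weak order\<close>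

text \<open>Phrased through inversion sets alone, so that joins are handled as inclusions between
  sets of roots in any signed groupoid set, where such a \<open>g\<close> may fail to be
  unique.\<close>

definition weak_join ::
    "('o, 'm, 'x, 'e) signed_groupoid_set_scheme \<Rightarrow> 'o \<Rightarrow> 'm set \<Rightarrow> 'm \<Rightarrow> bool" where
  "weak_join R a A g \<longleftrightarrow> g \<in> mors_into R a \<and> (\<forall>f\<in>A. inversions R f \<subseteq> inversions R g) \<and>
     (\<forall>h\<in>mors_into R a. (\<forall>f\<in>A. inversions R f \<subseteq> inversions R h) \<longrightarrow> inversions R g \<subseteq> inversions R h)"

lemma weak_join_iff_least:
  assumes "A \<subseteq> mors_into R a"
  shows "least (weak_order R a) g (Upper (weak_order R a) A) \<longleftrightarrow> weak_join R a A g"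
proof -
  have "Upper (weak_order R a) A =
      {h \<in> mors_into R a. \<forall>f\<in>A. inversions R f \<subseteq> inversions R h}"
    using assms by (auto simp: Upper_def weak_order_def)
  then show ?thesis by (auto simp: weak_join_def least_def weak_order_def)
qed

text \<open>The supremum of all lower bounds of \<open>A\<close> is the infimum of \<open>A\<close>,
  because every element of \<open>A\<close> is an upper bound of \<open>Lower L A\<close>.\<close>

lemma (in partial_order) complete_lattice_if_sups:
  assumes sup: "\<And>A. A \<subseteq> carrier L \<Longrightarrow> \<exists>s. least L s (Upper L A)"
  shows "complete_lattice L"
proof
  fix A assume A: "A \<subseteq> carrier L"
  show "\<exists>s. least L s (Upper L A)" using sup[OF A] .
  obtain s where s: "least L s (Upper L (Lower L A))" using sup[OF Lower_closed] by blast
  have "greatest L s (Lower L A)"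
    using s A unfolding least_def greatest_def Upper_def Lower_def by blast
  then show "\<exists>i. greatest L i (Lower L A)" ..
qed

section \<open>Inverses and cancellation in a groupoid\<close>

context groupoid
begin

lemma ginv_ginv: "f \<in> mor R \<Longrightarrow> ginv R (ginv R f) = f"
  using ginv[of f] ginv_unique[of "ginv R f" f] by simp

lemma cmp_ginv_cancel:
  assumes "f \<in> mor R" "h \<in> mor R" "tgt R h = tgt R f"
  shows "f \<cdot> (ginv R f \<cdot> h) = h"
  using assms ginv[of f] cmp_assoc[of f "ginv R f" h] idm_left[of h] by simp

lemma ginv_cmp:
  assumes "f \<in> mor R" "k \<in> mor R" "tgt R k = src R f"
  shows "ginv R (f \<cdot> k) = ginv R k \<cdot> ginv R f"
proof -
  note f = ginv[OF assms(1)] and k = ginv[OF assms(2)]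
  have fk: "f \<cdot> k \<in> mor R" "src R (f \<cdot> k) = src R k" "tgt R (f \<cdot> k) = tgt R f"
    using assms cmp_closed src_cmp tgt_cmp by auto
  have kf: "ginv R k \<cdot> ginv R f \<in> mor R" "src R (ginv R k \<cdot> ginv R f) = tgt R f"
      "tgt R (ginv R k \<cdot> ginv R f) = src R k"
    using assms f k cmp_closed src_cmp tgt_cmp by auto
  have "ginv R k \<cdot> ginv R f \<cdot> (f \<cdot> k) = ginv R k \<cdot> (ginv R f \<cdot> (f \<cdot> k))"
    using assms f k fk cmp_assoc by simp
  also have "ginv R f \<cdot> (f \<cdot> k) = k"
    using cmp_ginv_cancel[of "ginv R f" k] f ginv_ginv assms by simp
  finally have l: "ginv R k \<cdot> ginv R f \<cdot> (f \<cdot> k) = idm R (src R k)" using k by simp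
  have "f \<cdot> k \<cdot> (ginv R k \<cdot> ginv R f) = f \<cdot> (k \<cdot> (ginv R k \<cdot> ginv R f))"
    using assms f k kf cmp_assoc by simp
  also have "k \<cdot> (ginv R k \<cdot> ginv R f) = ginv R f"
    using cmp_ginv_cancel[of k "ginv R f"] f assms by simp
  finally have "f \<cdot> k \<cdot> (ginv R k \<cdot> ginv R f) = idm R (tgt R f)" using f by simp
  with l show ?thesis using ginv_unique[OF fk(1)] fk kf by simp
qed

lemma cmp_mors_into:
  "f \<in> mors_into R b \<Longrightarrow> k \<in> mors_into R (src R f) \<Longrightarrow> f \<cdot> k \<in> mors_into R b"
  using cmp_closed tgt_cmp by (simp add: mors_into_def)

end

section \<open>Signs of roots and membership in inversion sets\<close>

context signed_groupoid_set
begin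

lemma pos_subset: "a \<in> obj R \<Longrightarrow> pos R a \<subseteq> roots R a"
  using involuted[of a] by (auto simp: definitely_involuted_def)

lemma neg_roots: "a \<in> obj R \<Longrightarrow> \<alpha> \<in> roots R a \<Longrightarrow> neg R a \<alpha> \<in> roots R a"
  using involuted[of a] by (auto simp: definitely_involuted_def)

lemma neg_neg: "a \<in> obj R \<Longrightarrow> \<alpha> \<in> roots R a \<Longrightarrow> neg R a (neg R a \<alpha>) = \<alpha>"
  using involuted[of a] by (auto simp: definitely_involuted_def)

lemma mem_neg_pos_iff:
  "a \<in> obj R \<Longrightarrow> \<alpha> \<in> roots R a \<Longrightarrow> \<alpha> \<in> neg R a ` pos R a \<longleftrightarrow> \<alpha> \<notin> pos R a"
  using involuted[of a] by (auto simp: definitely_involuted_def)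

lemma neg_mem_pos_iff:
  assumes "a \<in> obj R" "\<alpha> \<in> roots R a"
  shows "neg R a \<alpha> \<in> pos R a \<longleftrightarrow> \<alpha> \<notin> pos R a"
proof
  assume "neg R a \<alpha> \<in> pos R a"
  then have "\<alpha> \<in> neg R a ` pos R a" using neg_neg[OF assms] by (metis imageI)
  then show "\<alpha> \<notin> pos R a" using mem_neg_pos_iff[OF assms] by simp
next
  assume "\<alpha> \<notin> pos R a"
  then obtain \<beta> where "\<beta> \<in> pos R a" "\<alpha> = neg R a \<beta>" using mem_neg_pos_iff[OF assms] by blast
  then show "neg R a \<alpha> \<in> pos R a" using neg_neg[of a \<beta>] pos_subset[of a] assms(1) by auto
qed

lemma act_ginv_closed:
  "f \<in> mor R \<Longrightarrow> \<alpha> \<in> roots R (tgt R f) \<Longrightarrow> act R (ginv R f) \<alpha> \<in> roots R (src R f)"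
  using act_closed[of "ginv R f" \<alpha>] ginv[of f] by simp

lemma act_act_ginv:
  "f \<in> mor R \<Longrightarrow> \<alpha> \<in> roots R (tgt R f) \<Longrightarrow> act R f (act R (ginv R f) \<alpha>) = \<alpha>"
  using act_ginv_act[of "ginv R f" \<alpha>] ginv[of f] ginv_ginv[of f] by simp

lemma act_ginv_neg:
  "f \<in> mor R \<Longrightarrow> \<alpha> \<in> roots R (tgt R f) \<Longrightarrow>
    act R (ginv R f) (neg R (tgt R f) \<alpha>) = neg R (src R f) (act R (ginv R f) \<alpha>)"
  using act_neg[of "ginv R f" \<alpha>] ginv[of f] by simp

text \<open>Each root is either positive or negative, so "negative" may be replaced by "not
  positive"; later sign arguments thereby become propositional.\<close>

lemma mem_inversions_iff:
  assumes "g \<in> mor R"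
  shows "\<alpha> \<in> inversions R g \<longleftrightarrow> \<alpha> \<in> pos R (tgt R g) \<and> act R (ginv R g) \<alpha> \<notin> pos R (src R g)"
  using assms mem_neg_pos_iff[OF src_closed[OF assms]] act_ginv_closed[OF assms]
    pos_subset[OF tgt_closed[OF assms]] unfolding inversions_def by blast

lemma mem_inversions_ginv_iff:
  assumes "f \<in> mor R"
  shows "\<beta> \<in> inversions R (ginv R f) \<longleftrightarrow> \<beta> \<in> pos R (src R f) \<and> act R f \<beta> \<notin> pos R (tgt R f)"
  using mem_inversions_iff[of "ginv R f" \<beta>] assms ginv[of f] ginv_ginv[of f] by simp

lemma mem_inversions_cmp_iff:
  assumes "f \<in> mor R" "k \<in> mor R" "tgt R k = src R f" "\<alpha> \<in> roots R (tgt R f)"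
  shows "\<alpha> \<in> inversions R (f \<cdot> k) \<longleftrightarrow>
    \<alpha> \<in> pos R (tgt R f) \<and> act R (ginv R k) (act R (ginv R f) \<alpha>) \<notin> pos R (src R k)"
  using assms mem_inversions_iff[of "f \<cdot> k" \<alpha>] cmp_closed[of f k] src_cmp[of f k] tgt_cmp[of f k]
    ginv_cmp[of f k] ginv[of f] ginv[of k] act_cmp[of "ginv R k" "ginv R f" \<alpha>] by simp

section \<open>Inversion sets of products and orthogonality\<close>

text \<open>A root \<beta> of \<open>\<Phi>\<^sub>k\<close> with f(\<beta>) negative would remove
  -f(\<beta>) from \<open>\<Phi>\<^sub>f\<close>. Orthogonality excludes exactly such \<beta>, so
  nothing cancels in the product.\<close>

lemma inversions_cmp:
  assumes f: "f \<in> mor R" and k: "k \<in> mor R" "tgt R k = src R f"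
    and orth: "inversions R k \<inter> inversions R (ginv R f) = {}"
  shows "inversions R (f \<cdot> k) = inversions R f \<union> act R f ` inversions R k"
proof (rule Set.set_eqI)
  fix \<alpha>
  note sub = pos_subset[OF src_closed[OF f]] pos_subset[OF tgt_closed[OF f]]
  show "\<alpha> \<in> inversions R (f \<cdot> k) \<longleftrightarrow> \<alpha> \<in> inversions R f \<union> act R f ` inversions R k"
  proof (cases "\<alpha> \<in> roots R (tgt R f)")
    case False
    moreover have "inversions R (f \<cdot> k) \<subseteq> roots R (tgt R f)"
      using inversions_subset cmp_closed tgt_cmp f k by metis
    moreover have "act R f ` inversions R k \<subseteq> roots R (tgt R f)"
      using act_closed[OF f] inversions_subset[OF k(1)] k(2) by auto
    ultimately show ?thesis using inversions_subset[OF f] by blast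
  next
    case True
    define \<beta> where "\<beta> = act R (ginv R f) \<alpha>"
    have \<beta>: "\<beta> \<in> roots R (src R f)" "act R f \<beta> = \<alpha>"
      using act_ginv_closed act_act_ginv f True unfolding \<beta>_def by auto
    have im: "\<alpha> \<in> act R f ` inversions R k \<longleftrightarrow> \<beta> \<in> inversions R k"
      using \<beta> act_ginv_act[OF f] inversions_subset[OF k(1)] k(2) unfolding \<beta>_def by force
    have fi: "\<alpha> \<in> inversions R f \<longleftrightarrow> \<alpha> \<in> pos R (tgt R f) \<and> \<beta> \<notin> pos R (src R f)"
      using mem_inversions_iff[OF f] unfolding \<beta>_def .
    have fki: "\<alpha> \<in> inversions R (f \<cdot> k) \<longleftrightarrow>
        \<alpha> \<in> pos R (tgt R f) \<and> act R (ginv R k) \<beta> \<notin> pos R (src R k)"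
      using mem_inversions_cmp_iff[OF f k True] unfolding \<beta>_def .
    have ki: "\<gamma> \<in> inversions R k \<longleftrightarrow> \<gamma> \<in> pos R (src R f) \<and> act R (ginv R k) \<gamma> \<notin> pos R (src R k)" for \<gamma>
      using mem_inversions_iff[OF k(1)] k(2) by simp
    \<comment> \<open>Orthogonality in usable form: \<open>f\<close> keeps the roots of
      \<open>\<Phi>\<^sub>k\<close> positive.\<close>
    have o: "act R f \<gamma> \<in> pos R (tgt R f)" if "\<gamma> \<in> inversions R k" for \<gamma>
      using that orth mem_inversions_ginv_iff[OF f, of \<gamma>] ki[of \<gamma>] by blast
    \<comment> \<open>When \<beta> is negative, membership in \<open>\<Phi>\<^sub>k\<close> has to
      be tested on -\<beta>; \<open>n\<close> says that all three signs involved switch.\<close>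
    let ?n = "neg R (src R f) \<beta>"
    have n: "?n \<in> pos R (src R f) \<longleftrightarrow> \<beta> \<notin> pos R (src R f)"
      "act R f ?n \<in> pos R (tgt R f) \<longleftrightarrow> \<alpha> \<notin> pos R (tgt R f)"
      "act R (ginv R k) ?n \<in> pos R (src R k) \<longleftrightarrow> act R (ginv R k) \<beta> \<notin> pos R (src R k)"
      using neg_mem_pos_iff src_closed tgt_closed f k \<beta> True act_neg[OF f \<beta>(1)]
        act_ginv_neg[OF k(1), of \<beta>] act_ginv_closed[OF k(1), of \<beta>] by auto
    show ?thesis using im fi fki ki[of \<beta>] ki[of ?n] o[of \<beta>] o[of ?n] n \<beta>(2) by auto
  qed
qed

text \<open>Converse to \<open>inversions_cmp\<close>: a common root \<beta> would make -f(\<beta>)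
  an inversion of \<open>f\<close> but not of \<open>f \<cdot> k\<close>. Hence orthogonality of
  \<open>k\<close> and \<open>ginv R f\<close> amounts to \<open>f\<close> lying below
  \<open>f \<cdot> k\<close>.\<close>

lemma orthogonal_if_le_cmp:
  assumes f: "f \<in> mor R" and k: "k \<in> mor R" "tgt R k = src R f"
    and le: "inversions R f \<subseteq> inversions R (f \<cdot> k)"
  shows "inversions R k \<inter> inversions R (ginv R f) = {}"
proof (rule ccontr)
  assume "inversions R k \<inter> inversions R (ginv R f) \<noteq> {}"
  then obtain \<beta> where "\<beta> \<in> inversions R k" "\<beta> \<in> inversions R (ginv R f)" by blast
  then have \<beta>: "\<beta> \<in> pos R (src R f)" "act R f \<beta> \<notin> pos R (tgt R f)"
      "act R (ginv R k) \<beta> \<notin> pos R (src R k)"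
    using mem_inversions_iff[OF k(1)] mem_inversions_ginv_iff[OF f] by auto
  have \<beta>r: "\<beta> \<in> roots R (src R f)" using \<beta>(1) pos_subset src_closed f by blast
  define \<alpha> where "\<alpha> = neg R (tgt R f) (act R f \<beta>)"
  have \<alpha>r: "\<alpha> \<in> roots R (tgt R f)" unfolding \<alpha>_def using neg_roots tgt_closed act_closed f \<beta>r by blast
  have \<alpha>: "\<alpha> \<in> pos R (tgt R f)" unfolding \<alpha>_def
    using neg_mem_pos_iff tgt_closed act_closed f \<beta>r \<beta>(2) by blast
  have a: "act R (ginv R f) \<alpha> = neg R (src R f) \<beta>"
    unfolding \<alpha>_def using act_ginv_neg[OF f act_closed[OF f \<beta>r]] act_ginv_act[OF f \<beta>r] by simp
  have "\<alpha> \<in> inversions R f"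
    using mem_inversions_iff[OF f] \<alpha> a neg_mem_pos_iff src_closed f \<beta>r \<beta>(1) by auto
  then have "act R (ginv R k) (neg R (src R f) \<beta>) \<notin> pos R (src R k)"
    using le mem_inversions_cmp_iff[OF f k \<alpha>r] a by auto
  then show False
    using act_ginv_neg[OF k(1), of \<beta>] k(2) \<beta>r \<beta>(3) neg_mem_pos_iff[OF src_closed[OF k(1)]]
      act_ginv_closed[OF k(1), of \<beta>] by simp
qed

text \<open>The inverse of \<open>f\<close> makes the roots of \<open>\<Phi>\<^sub>f\<close>
  negative, but sends those of the image back into \<open>\<Phi>\<^sub>k\<close>, which is positive.
  The union in \<open>inversions_cmp\<close> is therefore disjoint.\<close>

lemma inversions_disjoint_image:
  assumes "f \<in> mor R" "k \<in> mor R" "tgt R k = src R f"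
  shows "inversions R f \<inter> act R f ` inversions R k = {}"
  using assms mem_inversions_iff[of f] mem_inversions_iff[of k] act_ginv_act[of f]
    pos_subset[OF src_closed[of f]] by force

lemma orthogonal_if_image_subset_pos:
  assumes "f \<in> mor R" "act R f ` S \<subseteq> pos R (tgt R f)"
  shows "S \<inter> inversions R (ginv R f) = {}"
  using assms mem_inversions_ginv_iff[of f] by blast

text \<open>Both products split off the common part \<open>\<Phi>\<^sub>f\<close>. Removing it
  leaves an inclusion of images under \<open>f\<close>, and the action of \<open>f\<close> is
  injective.\<close>

lemma inversions_subset_if_cmp_subset:
  assumes f: "f \<in> mor R" and z: "z \<in> mors_into R (src R f)" and k: "k \<in> mors_into R (src R f)"
    and orth: "inversions R z \<inter> inversions R (ginv R f) = {}"
      "inversions R k \<inter> inversions R (ginv R f) = {}"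
    and le: "inversions R (f \<cdot> z) \<subseteq> inversions R (f \<cdot> k)"
  shows "inversions R z \<subseteq> inversions R k"
proof -
  have zk: "z \<in> mor R" "tgt R z = src R f" "k \<in> mor R" "tgt R k = src R f"
    using z k by (auto simp: mors_into_def)
  have "act R f ` inversions R z \<subseteq> act R f ` inversions R k"
    using le inversions_cmp[OF f zk(1,2) orth(1)] inversions_cmp[OF f zk(3,4) orth(2)]
      inversions_disjoint_image[OF f zk(1,2)] by blast
  moreover have "inj_on (act R f) (roots R (src R f))"
    using act_ginv_act[OF f] by (metis inj_onI)
  ultimately show ?thesis
    using inversions_subset[OF zk(1)] inversions_subset[OF zk(3)] zk(2,4)
    by (auto simp: inj_on_def subset_iff image_iff) metis
qed

section \<open>Reflecting squares along the diagonal\<close>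

text \<open>The diagonal \<open>f \<cdot> x\<close> has inversion set the disjoint union of
  \<open>\<Phi>\<^sub>f\<close> and \<open>\<Phi>\<^sub>y\<close>. Thus \<open>y\<close> lies below
  it, and splitting it as \<open>y \<cdot> z\<close> shows that the image of
  \<open>\<Phi>\<^sub>z\<close> is the complement of \<open>\<Phi>\<^sub>y\<close>, namely
  \<open>\<Phi>\<^sub>f\<close>.\<close>

lemma square_flip:
  assumes f: "f \<in> mors_into R b" and y: "y \<in> mors_into R b" and x: "x \<in> mors_into R (src R f)"
    and sq: "act R f ` inversions R x = inversions R y"
  obtains z where "z \<in> mors_into R (src R y)" "act R y ` inversions R z = inversions R f"
proof
  have m: "f \<in> mor R" "tgt R f = b" "y \<in> mor R" "tgt R y = b" "x \<in> mor R" "tgt R x = src R f"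
    using f y x by (auto simp: mors_into_def)
  have fx: "f \<cdot> x \<in> mor R" "tgt R (f \<cdot> x) = b" using m cmp_closed tgt_cmp by auto
  \<comment> \<open>Commutativity of the square forces this choice.\<close>
  define z where "z = ginv R y \<cdot> (f \<cdot> x)"
  have yz: "y \<cdot> z = f \<cdot> x" unfolding z_def using cmp_ginv_cancel m fx by simp
  show z: "ginv R y \<cdot> (f \<cdot> x) \<in> mors_into R (src R y)"
    using m fx ginv[of y] cmp_closed tgt_cmp by (simp add: mors_into_def)
  then have zm: "z \<in> mor R" "tgt R z = src R y" by (auto simp: z_def mors_into_def)
  have "inversions R x \<inter> inversions R (ginv R f) = {}"
    using orthogonal_if_image_subset_pos[OF m(1)] sq m mem_inversions_iff[OF m(3)] by auto
  from inversions_cmp[OF m(1,5,6) this] have u: "inversions R (y \<cdot> z) = inversions R f \<union> inversions R y"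
    using sq yz by simp
  then have "inversions R (y \<cdot> z) = inversions R y \<union> act R y ` inversions R z"
    using inversions_cmp[OF m(3) zm] orthogonal_if_le_cmp[OF m(3) zm] by blast
  moreover have "inversions R f \<inter> inversions R y = {}"
    using inversions_disjoint_image[OF m(1,5,6)] sq by simp
  ultimately show "act R y ` inversions R (ginv R y \<cdot> (f \<cdot> x)) = inversions R f"
    unfolding z_def[symmetric]
    using u inversions_disjoint_image[OF m(3) zm] by (simp add: set_eq_iff) metis
qed

section \<open>Orthogonality and squares under joins\<close>

lemma orthogonal_weak_join:
  assumes ex: "\<And>A. A \<subseteq> mors_into R (src R p) \<Longrightarrow> \<exists>u. weak_join R (src R p) A u"
    and p: "p \<in> mor R" and B: "B \<subseteq> mors_into R (tgt R p)" and z: "weak_join R (tgt R p) B z"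
    and orth: "\<And>w. w \<in> B \<Longrightarrow> inversions R w \<inter> inversions R p = {}"
  shows "inversions R z \<inter> inversions R p = {}"
proof -
  define f where "f = ginv R p"
  have f: "f \<in> mor R" "src R f = tgt R p" "tgt R f = src R p" "ginv R f = p"
    unfolding f_def using ginv[OF p] ginv_ginv[OF p] by auto
  \<comment> \<open>Including \<open>f\<close> itself guarantees that the join \<open>u\<close> lies
    above \<open>f\<close>, also when \<open>B\<close> is empty.\<close>
  have "insert f ((\<lambda>w. f \<cdot> w) ` B) \<subseteq> mors_into R (src R p)"
    using f B cmp_mors_into[of f "src R p"] by (auto simp: mors_into_def)
  then obtain u where u: "weak_join R (src R p) (insert f ((\<lambda>w. f \<cdot> w) ` B)) u" using ex by blast
  then have um: "u \<in> mor R" "tgt R u = src R p" by (auto simp: weak_join_def mors_into_def)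
  \<comment> \<open>Translating \<open>u\<close> back gives an upper bound \<open>k\<close> of
    \<open>B\<close> that is orthogonal to \<open>p\<close>. The join \<open>z\<close> lies below
    \<open>k\<close> and inherits the orthogonality.\<close>
  define k where "k = p \<cdot> u"
  have k: "k \<in> mors_into R (tgt R p)"
    unfolding k_def using cmp_mors_into[of p "tgt R p" u] p um by (simp add: mors_into_def)
  have fk: "f \<cdot> k = u" using cmp_ginv_cancel[of f u] f um unfolding k_def by simp
  have o: "inversions R k \<inter> inversions R (ginv R f) = {}"
    using orthogonal_if_le_cmp[OF f(1)] k f u fk by (auto simp: weak_join_def mors_into_def)
  have "inversions R w \<subseteq> inversions R k" if w: "w \<in> B" for w
    using inversions_subset_if_cmp_subset[OF f(1), of w k] w B k f orth[OF w] o fk u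
    by (auto simp: weak_join_def)
  then have "inversions R z \<subseteq> inversions R k" using z k by (simp add: weak_join_def)
  then show ?thesis using o f by auto
qed

text \<open>\<open>y \<cdot> z\<close> is an upper bound of \<open>A\<close>, so
  \<open>\<Phi>\<^sub>g\<close> lies in the union of \<open>\<Phi>\<^sub>y\<close> and the image of
  \<open>\<Phi>\<^sub>z\<close>, and by orthogonality it avoids \<open>\<Phi>\<^sub>y\<close>. The
  hypotheses match \<open>A\<close> and \<open>B\<close> in both directions so that the lemma also
  applies to \<open>ginv R y\<close> with the two sets exchanged.\<close>

lemma weak_join_image_subset:
  assumes ex: "\<And>a A. a \<in> obj R \<Longrightarrow> A \<subseteq> mors_into R a \<Longrightarrow> \<exists>u. weak_join R a A u"
    and y: "y \<in> mor R" and A: "A \<subseteq> mors_into R (tgt R y)" and B: "B \<subseteq> mors_into R (src R y)"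
    and g: "weak_join R (tgt R y) A g" and z: "weak_join R (src R y) B z"
    and AB: "\<And>f. f \<in> A \<Longrightarrow> \<exists>w\<in>B. act R y ` inversions R w = inversions R f"
    and BA: "\<And>w. w \<in> B \<Longrightarrow> \<exists>f\<in>A. act R y ` inversions R w = inversions R f"
  shows "inversions R g \<subseteq> act R y ` inversions R z"
proof -
  note yi = ginv[OF y]
  have zm: "z \<in> mor R" "tgt R z = src R y" using z by (auto simp: weak_join_def mors_into_def)
  \<comment> \<open>\<open>y\<close> maps \<open>\<Phi>\<^sub>w\<close> onto some
    \<open>\<Phi>\<^sub>f\<close>, hence to positive roots. Dually, \<open>oa\<close> holds because
    such an image never meets \<open>\<Phi>\<^sub>y\<close>.\<close>
  have ob: "inversions R w \<inter> inversions R (ginv R y) = {}" if w: "w \<in> B" for w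
  proof -
    obtain f where "f \<in> A" "act R y ` inversions R w = inversions R f" using BA[OF w] by blast
    moreover have "inversions R f \<subseteq> pos R (tgt R y)"
      using A \<open>f \<in> A\<close> by (auto simp: mors_into_def inversions_def)
    ultimately show ?thesis using orthogonal_if_image_subset_pos[OF y] by simp
  qed
  have oa: "inversions R f \<inter> inversions R y = {}" if f: "f \<in> A" for f
  proof -
    obtain w where "w \<in> B" "act R y ` inversions R w = inversions R f" using AB[OF f] by blast
    then show ?thesis using inversions_disjoint_image[OF y, of w] B by (auto simp: mors_into_def)
  qed
  have "inversions R z \<inter> inversions R (ginv R y) = {}"
    using orthogonal_weak_join[of "ginv R y" B z] ex[OF tgt_closed[OF y]] yi B z ob by simp
  from inversions_cmp[OF y zm this]
  have yz: "inversions R (y \<cdot> z) = inversions R y \<union> act R y ` inversions R z" .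
  have "inversions R f \<subseteq> inversions R (y \<cdot> z)" if f: "f \<in> A" for f
  proof -
    obtain w where w: "w \<in> B" "act R y ` inversions R w = inversions R f" using AB[OF f] by blast
    then have "inversions R w \<subseteq> inversions R z" using z by (simp add: weak_join_def)
    then show ?thesis using w yz by blast
  qed
  moreover have "y \<cdot> z \<in> mors_into R (tgt R y)"
    using cmp_mors_into[of y "tgt R y" z] y zm by (simp add: mors_into_def)
  ultimately have "inversions R g \<subseteq> inversions R (y \<cdot> z)" using g by (simp add: weak_join_def)
  \<comment> \<open>Orthogonality to \<open>y\<close> passes from the members of \<open>A\<close> to
    their join.\<close>
  moreover have "inversions R g \<inter> inversions R y = {}"
    using orthogonal_weak_join[OF _ y A g oa] ex[OF src_closed[OF y]] by blast
  ultimately show ?thesis using yz by blast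
qed

lemma weak_join_image_eq:
  assumes ex: "\<And>a A. a \<in> obj R \<Longrightarrow> A \<subseteq> mors_into R a \<Longrightarrow> \<exists>u. weak_join R a A u"
    and y: "y \<in> mor R" and A: "A \<subseteq> mors_into R (tgt R y)" and g: "weak_join R (tgt R y) A g"
    and AB: "\<And>f. f \<in> A \<Longrightarrow> \<exists>w\<in>mors_into R (src R y). act R y ` inversions R w = inversions R f"
  obtains z where "z \<in> mors_into R (src R y)" "act R y ` inversions R z = inversions R g"
proof -
  \<comment> \<open>All partners of members of \<open>A\<close>, so that the matching holds in both
    directions; the join of \<open>B\<close> is the required \<open>z\<close>.\<close>
  define B where "B = {w \<in> mors_into R (src R y). \<exists>f\<in>A. act R y ` inversions R w = inversions R f}"
  have B: "B \<subseteq> mors_into R (src R y)" unfolding B_def by blast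
  obtain z where z: "weak_join R (src R y) B z" using ex[OF src_closed[OF y] B] by blast
  note yi = ginv[OF y] ginv_ginv[OF y]
  have AB': "\<exists>w\<in>B. act R y ` inversions R w = inversions R f" if "f \<in> A" for f
    using AB[OF that] that unfolding B_def by blast
  have BA': "\<exists>f\<in>A. act R y ` inversions R w = inversions R f" if "w \<in> B" for w
    using that unfolding B_def by blast
  have flip: "act R (ginv R y) ` inversions R f = inversions R w"
    if "w \<in> B" "act R y ` inversions R w = inversions R f" for f w
    using inversions_eq_image_ginv[OF y _ _ that(2)] that(1) B by (auto simp: mors_into_def)
  have gz: "inversions R g \<subseteq> act R y ` inversions R z"
    by (rule weak_join_image_subset[OF ex y A B g z AB' BA'])
  \<comment> \<open>The same inclusion for the inverse of \<open>y\<close>, with \<open>A\<close>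
    and \<open>B\<close> exchanged; applying \<open>y\<close> turns it into the missing
    half.\<close>
  have "inversions R z \<subseteq> act R (ginv R y) ` inversions R g"
  proof (rule weak_join_image_subset[OF ex yi(1)])
    show "\<exists>f\<in>A. act R (ginv R y) ` inversions R f = inversions R w" if "w \<in> B" for w
      using BA'[OF that] flip that by blast
    show "\<exists>w\<in>B. act R (ginv R y) ` inversions R f = inversions R w" if "f \<in> A" for f
      using AB'[OF that] flip by blast
  qed (use yi A B g z in simp_all)
  then have "act R y ` inversions R z \<subseteq> act R y ` act R (ginv R y) ` inversions R g" by blast
  also have "\<dots> = inversions R g"
  proof -
    have "inversions R g \<subseteq> roots R (tgt R y)"
      using g inversions_subset[of g] by (auto simp: weak_join_def mors_into_def)
    then show ?thesis using act_act_ginv[OF y] by (force simp: image_image subset_iff)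
  qed
  finally show thesis using gz z that by (auto simp: weak_join_def)
qed

end

section \<open>Completeness and finiteness of \<open>box R\<close>\<close>

context faithful_signed_groupoid_set
begin

text \<open>Faithfulness enters through antisymmetry, which is
  \<open>inversions_inj\<close>.\<close>

lemma weak_order_partial_order: "partial_order (weak_order R a)"
  by unfold_locales (auto simp: weak_order_def mors_into_def intro: inversions_inj)

lemma complete_weak_order_iff:
  "complete_lattice (weak_order R a) \<longleftrightarrow> (\<forall>A\<subseteq>mors_into R a. \<exists>g. weak_join R a A g)"
proof
  assume "complete_lattice (weak_order R a)"
  then interpret C: complete_lattice "weak_order R a" .
  show "\<forall>A\<subseteq>mors_into R a. \<exists>g. weak_join R a A g"
    using C.sup_exists weak_join_iff_least[of _ R a] by (simp add: weak_order_def)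
next
  assume joins: "\<forall>A\<subseteq>mors_into R a. \<exists>g. weak_join R a A g"
  interpret P: partial_order "weak_order R a" by (rule weak_order_partial_order)
  show "complete_lattice (weak_order R a)"
    using joins weak_join_iff_least[of _ R a]
    by (intro P.complete_lattice_if_sups) (simp add: weak_order_def)
qed

text \<open>The source set \<open>X\<close> is constructed: one \<open>x\<close> is chosen for each
  \<open>y\<close>, and the inverse of this choice is the bijection that a morphism of
  \<open>box R\<close> requires.\<close>

lemma box_mor_intoI:
  assumes f: "f \<in> mors_into R b" and Y: "Y \<subseteq> mors_into R b"
    and ex: "\<And>y. y \<in> Y \<Longrightarrow> \<exists>x\<in>mors_into R (src R f). act R f ` inversions R x = inversions R y"
  obtains X where "((src R f, X), f, (b, Y)) \<in> box_mors R"
proof -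
  obtain \<tau> where \<tau>: "\<And>y. y \<in> Y \<Longrightarrow> \<tau> y \<in> mors_into R (src R f)"
      "\<And>y. y \<in> Y \<Longrightarrow> act R f ` inversions R (\<tau> y) = inversions R y"
    using ex by metis
  \<comment> \<open>The chosen \<open>x\<close> determines \<open>\<Phi>\<^sub>y\<close>, and by
    faithfulness this determines \<open>y\<close> among the morphisms into \<open>b\<close>.\<close>
  have inj: "inj_on \<tau> Y"
    using \<tau>(2) Y inversions_inj by (auto simp: inj_on_def mors_into_def subset_iff) metis
  have "bij_betw (inv_into Y \<tau>) (\<tau> ` Y) Y"
    using inj by (simp add: bij_betw_inv_into inj_on_imp_bij_betw)
  moreover have "\<forall>g\<in>\<tau> ` Y. act R f ` inversions R g = inversions R (inv_into Y \<tau> g)"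
    using \<tau>(2) inj by simp
  ultimately have "((src R f, \<tau> ` Y), f, (b, Y)) \<in> box_mors R"
    unfolding mem_box_mors_iff using f Y \<tau>(1) by (auto simp: mors_into_def)
  then show thesis by (rule that)
qed

text \<open>Forgetting sources and targets preserves inversion sets, so the join \<open>g\<close> of
  the underlying morphisms is the right candidate once it is known to underlie a morphism into
  \<open>(b, Y)\<close>. This is checked for each \<open>y\<close> separately.\<close>

lemma box_weak_join_exists:
  assumes ex: "\<And>a A. a \<in> obj R \<Longrightarrow> A \<subseteq> mors_into R a \<Longrightarrow> \<exists>u. weak_join R a A u"
    and bY: "(b, Y) \<in> box_objs R" and P: "P \<subseteq> mors_into (box R) (b, Y)"
  shows "\<exists>q. weak_join (box R) (b, Y) P q"
proof -
  define u :: "('a, 'b) box_mor \<Rightarrow> 'b" where "u p = fst (snd p)" for p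
  have b: "b \<in> obj R" and Y: "Y \<subseteq> mors_into R b" using bY by (auto simp: box_objs_def)
  have into: "\<exists>a X. p = ((a, X), u p, (b, Y)) \<and> p \<in> box_mors R" if "p \<in> mors_into (box R) (b, Y)" for p
    using that unfolding u_def by (cases p) (auto simp: mors_into_def box_def)
  have um: "u p \<in> mors_into R b" if "p \<in> mors_into (box R) (b, Y)" for p
  proof -
    from into[OF that] obtain C where "(C, u p, (b, Y)) \<in> box_mors R" by metis
    from box_mors_D[OF this] show ?thesis by (simp add: mors_into_def)
  qed
  have inv: "inversions (box R) p = inversions R (u p)" if "p \<in> mors_into (box R) (b, Y)" for p
    using into[OF that] inversions_box[of _ "u p" "(b, Y)"] by metis
  have A: "u ` P \<subseteq> mors_into R b" using um P by blast
  obtain g where g: "weak_join R b (u ` P) g" using ex[OF b A] by blast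
  then have gm: "g \<in> mors_into R b" by (simp add: weak_join_def)
  have "\<exists>x\<in>mors_into R (src R g). act R g ` inversions R x = inversions R y" if y: "y \<in> Y" for y
  proof -
    have yb: "y \<in> mors_into R b" using y Y by blast
    then have ym: "y \<in> mor R" "tgt R y = b" by (auto simp: mors_into_def)
    \<comment> \<open>Each \<open>f\<close> comes with a square ending in \<open>y\<close>;
      reflecting it puts the fixed \<open>y\<close> on the acting side, where joins can be
      taken.\<close>
    have AB: "\<exists>w\<in>mors_into R (src R y). act R y ` inversions R w = inversions R f"
      if f: "f \<in> u ` P" for f
    proof -
      obtain p where p: "p \<in> P" "f = u p" using f by blast
      have "p \<in> mors_into (box R) (b, Y)" using P p(1) by blast
      from into[OF this] obtain a X where "((a, X), f, (b, Y)) \<in> box_mors R" using p(2) by metis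
      then obtain \<sigma> where \<sigma>: "src R f = a" "X \<subseteq> mors_into R a" "bij_betw \<sigma> X Y"
          "\<And>x. x \<in> X \<Longrightarrow> act R f ` inversions R x = inversions R (\<sigma> x)"
        by (rule box_morsE) (rule that)
      then obtain x where x: "x \<in> X" "\<sigma> x = y" using y by (auto simp: bij_betw_def)
      then obtain z where "z \<in> mors_into R (src R y)" "act R y ` inversions R z = inversions R f"
        using square_flip[of f b y x] \<sigma> yb f A by (metis subsetD)
      then show ?thesis by blast
    qed
    obtain z where "z \<in> mors_into R (src R y)" "act R y ` inversions R z = inversions R g"
      \<comment> \<open>After passing to the join, the square is reflected back, now with
        \<open>g\<close> acting.\<close>
      using weak_join_image_eq[OF ex ym(1), of "u ` P" g] A g AB ym(2) by auto
    then obtain x where "x \<in> mors_into R (src R g)" "act R g ` inversions R x = inversions R y"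
      using square_flip[OF yb gm] by metis
    then show ?thesis by blast
  qed
  then obtain X where X: "((src R g, X), g, (b, Y)) \<in> box_mors R"
    using box_mor_intoI[OF gm Y] by metis
  let ?q = "((src R g, X), g, (b, Y))"
  have q: "?q \<in> mors_into (box R) (b, Y)" using X by (simp add: mors_into_def box_def)
  have "weak_join (box R) (b, Y) P ?q"
    unfolding weak_join_def
  proof (intro conjI ballI impI q)
    have uq: "inversions (box R) ?q = inversions R g" using inversions_box[OF X] .
    show "inversions (box R) p \<subseteq> inversions (box R) ?q" if p: "p \<in> P" for p
    proof -
      have "inversions (box R) p = inversions R (u p)" using inv p P by blast
      then show ?thesis using g p uq by (simp add: weak_join_def)
    qed
    show "inversions (box R) ?q \<subseteq> inversions (box R) h"
      if h: "h \<in> mors_into (box R) (b, Y)"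
        and ub: "\<forall>p\<in>P. inversions (box R) p \<subseteq> inversions (box R) h" for h
    proof -
      have "inversions R f \<subseteq> inversions R (u h)" if f: "f \<in> u ` P" for f
      proof -
        obtain p where p: "p \<in> P" "f = u p" using f by blast
        then have "inversions (box R) p = inversions R f" using inv P by blast
        then show ?thesis using ub p(1) inv[OF h] by blast
      qed
      then show ?thesis using g um[OF h] inv[OF h] uq by (simp add: weak_join_def)
    qed
  qed
  then show ?thesis ..
qed

lemma finite_box:
  assumes "finite_sgs R"
  shows "finite_sgs (box R)"
proof -
  have fm: "finite (mor R)" using assms by (simp add: finite_sgs_def)
  \<comment> \<open>\<open>finite_sgs\<close> speaks of morphisms and roots; the objects are counted
    through their identities.\<close>
  have "inj_on (idm R) (obj R)" using src_idm by (metis inj_onI)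
  then have "finite (obj R)" using fm idm_closed by (meson finite_subset image_subsetI inj_on_finite)
  moreover have "box_objs R \<subseteq> obj R \<times> Pow (mor R)" by (auto simp: box_objs_def mors_into_def)
  ultimately have "finite (box_objs R)" using fm finite_subset by blast
  moreover have "box_mors R \<subseteq> box_objs R \<times> mor R \<times> box_objs R" by (auto simp: box_mors_def)
  ultimately have "finite (box_mors R)" using fm by (meson finite_SigmaI finite_subset)
  then show ?thesis using assms by (auto simp: finite_sgs_def box_def box_objs_def)
qed

lemma complete_box:
  assumes "complete_sgs R"
  shows "complete_sgs (box R)"
proof -
  interpret B: faithful_signed_groupoid_set "box R" by (rule box_faithful_signed_groupoid_set)
  have ex: "\<exists>u. weak_join R a A u" if "a \<in> obj R" "A \<subseteq> mors_into R a" for a A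
    using assms that complete_weak_order_iff by (simp add: complete_sgs_def)
  have "\<exists>q. weak_join (box R) C P q"
    if C: "C \<in> obj (box R)" and P: "P \<subseteq> mors_into (box R) C" for C P
    using box_weak_join_exists[OF ex, of "fst C" "snd C" P] C P by (simp add: box_def)
  then show ?thesis by (simp add: complete_sgs_def B.complete_weak_order_iff)
qed

end

theorem proposition3p14:
  fixes R :: "('o, 'm, 'x) signed_groupoid_set"
  assumes "faithful_signed_groupoid_set R"
    and "finite_sgs R"
    and "complete_sgs R"
  shows "finite_sgs (box R) \<and> complete_sgs (box R)"
proof -
  interpret faithful_signed_groupoid_set R by fact
  show ?thesis using finite_box complete_box assms by blast
qed

end
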